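(* For every tree $T$ of order $n$, $\operatorname{th}_+(T) \leq \frac{\sqrt{14}}{2}\sqrt{n} + O(1)$; that is, there is an absolute constant $C$ such that $\operatorname{th}_+(T) \leq \frac{\sqrt{14}}{2}\sqrt{n} + C$ for every $n \ge 1$ and every tree $T$ with $n$ vertices.
   Context: Graphs are finite, simple and undirected; the order of a graph is its number of vertices. Positive semidefinite (PSD) zero forcing on a graph $G$ is the following coloring process. An initial set of vertices is colored blue, all others are white. In each round, let $S$ denote the set of blue vertices and let $W_1,\dots,W_r$ denote the sets of white vertices corresponding to the connected components of $G - S$. A blue vertex $v$ colors one of its white neighbors $w$ blue if for some $i$, $w$ is the only white neighbor of $v$ in the subgraph of $G$ induced by $W_i \cup S$; all such colorings are performed simultaneously in the round. The parameter $\operatorname{pt}_+(G,k)$ is the minimum possible number of rounds for all of $G$ to be colored blue when the set of initial blue vertices has size $k$ ($\infty$ if no initial set of size $k$ leads to all of $G$ being blue). The PSD throttling number is $\operatorname{th}_+(G) = \min_k \{k + \operatorname{pt}_+(G,k)\}$, over positive integers $k$. *)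

theory Defs
  imports "HOL-Library.Extended_Real" "Graph_Theory.Graph_Theory"
begin

text \<open>
  Finite simple undirected graphs are the symmetric digraphs of the locale
  \<^locale>\<open>graph\<close> (finite, loop-free, without parallel arcs), in which every
  undirected edge is a pair of opposite arcs. The library predicate \<^const>\<open>tree\<close>
  is not usable for such graphs, since it already counts the closed walk
  \<open>a, b, a\<close> along a single edge as a cycle; undirected cycles are exactly the
  library cycles of length at least 3. Connectedness includes having at least
  one vertex.
\<close>

definition undirected_tree :: "('a, 'b) pre_digraph \<Rightarrow> bool" where
  "undirected_tree G \<longleftrightarrow>
     graph G \<and> Digraph_Component.connected G \<and>
     \<not> (\<exists>p. pre_digraph.cycle G p \<and> 3 \<le> length p)"

text \<open>
  The vertex sets of the connected components of \<open>G - S\<close>. As arcs come in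
  opposite pairs, strongly connected components are connected components.
\<close>

definition white_components :: "('a, 'b) pre_digraph \<Rightarrow> 'a set \<Rightarrow> 'a set set" where
  "white_components G S = pre_digraph.sccs_verts (G \<restriction> (verts G - S))"

definition psd_forces :: "('a, 'b) pre_digraph \<Rightarrow> 'a set \<Rightarrow> 'a \<Rightarrow> 'a \<Rightarrow> bool" where
  "psd_forces G S v w \<longleftrightarrow>
     v \<in> S \<and> (\<exists>W \<in> white_components G S. {x. x \<notin> S \<and> v \<rightarrow>\<^bsub>G \<restriction> (W \<union> S)\<^esub> x} = {w})"

definition psd_round :: "('a, 'b) pre_digraph \<Rightarrow> 'a set \<Rightarrow> 'a set" where
  "psd_round G S = S \<union> {w. \<exists>v. psd_forces G S v w}"

text \<open>In \<^typ>\<open>enat\<close>, infima of nonempty sets are attained and the infimum of the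
  empty set is \<open>\<infinity>\<close>.\<close>

definition pt_plus :: "('a, 'b) pre_digraph \<Rightarrow> nat \<Rightarrow> enat" where
  "pt_plus G k =
     Inf {enat t | t S. S \<subseteq> verts G \<and> card S = k \<and> (psd_round G ^^ t) S = verts G}"

definition th_plus :: "('a, 'b) pre_digraph \<Rightarrow> enat" where
  "th_plus G = (INF k\<in>{1..}. enat k + pt_plus G k)"

end

theory Submission
  imports Defs
begin

text \<open>
  On a tree, a blue vertex has at most one neighbour in each white component, because two of them
  would close a cycle. Hence it forces all its white neighbours, the blue set grows by one
  unit of distance per round (\<open>tree_neighbour_forced\<close>, \<open>tree_near_forced\<close>), and it suffices to find
  a set \<open>S\<close> of vertices and a radius \<open>t\<close> such that every vertex is within distance \<open>t\<close> of
  \<open>S\<close> and \<open>|S| + t\<close> is small. Let \<open>n\<close> be the order of the tree, rooted at some vertex.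

  Repeatedly covering the deepest uncovered vertex by the ball of radius \<open>r\<close> about its \<open>r\<close>-th ancestor
  yields a cover that is no larger than some set of vertices at pairwise distance more than \<open>2 r\<close>
  (\<open>cover_packing\<close>). The \<open>r\<close>-balls about the latter are disjoint, so a lower bound for their
  sizes bounds the size of the cover. The bound \<open>r + 1\<close> for a single ball is attained at the
  tip of a long pendant path, and on its own would give only \<open>2 \<surd>n + O(1)\<close>.

  The gain comes from the core, the set of vertices that have a descendant \<open>r\<close> levels below. An \<open>r\<close>-ball
  about a vertex of depth at least \<open>r\<close>, at distance \<open>d\<close> below the core, has at least \<open>d\<close> vertices outside the core, and
  at least \<open>2 r + 1 - d\<close> vertices in total: it contains the centre, \<open>r\<close> ancestors and, as the core vertex above
  the centre has a descending path of length \<open>r\<close>, at least \<open>r - d\<close> vertices of that path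
  (\<open>ball_count\<close>). Summing over the disjoint balls gives a cover of radius \<open>r\<close> with
  \<open>(2 r + 1) (|S| - 1) + |core r| \<le> 2 n\<close> (\<open>cover_one_scale\<close>). So either the core is large and this cover
  is small, or the core is small; in the second case, cover the core with radius \<open>s\<close>,
  which takes about \<open>|core r| / (s + 1)\<close> vertices and covers the whole tree with radius \<open>r + s\<close>
  (\<open>cover_two_scales\<close>).

  With \<open>c = \<surd>14 / 2\<close>, the threshold \<open>2 n / 7\<close> for the size of the core and the radii
  \<open>r \<approx> (3 c / 7) \<surd>n\<close> and \<open>s \<approx> (2 c / 7) \<surd>n\<close>, both cases cost \<open>c \<surd>n + O(1)\<close>.
\<close>

section \<open>Rooted trees as parent functions\<close>

text \<open>
  When the parent function fixes the root and otherwise maps a vertex to its parent, this says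
  that \<open>x\<close> and \<open>y\<close> have distance at most \<open>t\<close> in the tree: the path between them goes up from
  both ends to a common ancestor. Working with iterates avoids walks altogether.
\<close>

definition near :: "('a \<Rightarrow> 'a) \<Rightarrow> nat \<Rightarrow> 'a \<Rightarrow> 'a \<Rightarrow> bool" where
  "near par t x y \<longleftrightarrow> (\<exists>i j. i + j \<le> t \<and> (par ^^ i) x = (par ^^ j) y)"

lemma nearI: "(par ^^ i) x = (par ^^ j) y \<Longrightarrow> i + j \<le> t \<Longrightarrow> near par t x y"
  unfolding near_def by blast

lemma near_sym: "near par t x y \<Longrightarrow> near par t y x"
  unfolding near_def by (metis add.commute)

text \<open>
  Both numbers of steps up from \<open>z\<close> count along the same chain of parents, so the ancestor reached
  by the longer climb is a common ancestor of all three vertices.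
\<close>

lemma near_trans:
  assumes "near par s x z" "near par t z y"
  shows "near par (s + t) x y"
proof -
  obtain i j where 1: "i + j \<le> s" "(par ^^ i) x = (par ^^ j) z"
    using assms(1) unfolding near_def by blast
  obtain a b where 2: "a + b \<le> t" "(par ^^ a) z = (par ^^ b) y"
    using assms(2) unfolding near_def by blast
  show ?thesis
  proof (cases "j \<le> a")
    case True
    have "(par ^^ (a - j + i)) x = (par ^^ (a - j)) ((par ^^ j) z)"
      using 1 by (simp add: funpow_add)
    also have "\<dots> = (par ^^ (a - j + j)) z"
      by (simp only: funpow_add o_apply)
    also have "\<dots> = (par ^^ b) y"
      using True 2 by simp
    finally show ?thesis
      by (rule nearI) (use 1 2 True in linarith)
  next
    case False
    have "(par ^^ (j - a + b)) y = (par ^^ (j - a)) ((par ^^ a) z)"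
      using 2 by (simp add: funpow_add)
    also have "\<dots> = (par ^^ (j - a + a)) z"
      by (simp only: funpow_add o_apply)
    also have "\<dots> = (par ^^ i) x"
      using False 1 by simp
    finally have "(par ^^ i) x = (par ^^ (j - a + b)) y" by simp
    then show ?thesis
      by (rule nearI) (use 1 2 False in linarith)
  qed
qed

text \<open>
  Truncated subtraction in \<open>dep_par\<close> makes the root a fixed point of \<open>par\<close>. Hence all
  \<open>i\<close>-th ancestors exist, being the root for large \<open>i\<close>.
\<close>

locale rooted_tree =
  fixes V :: "'a set" and apex :: 'a and par :: "'a \<Rightarrow> 'a" and dep :: "'a \<Rightarrow> nat"
  assumes finite_V: "finite V"
    and apex_in: "apex \<in> V"
    and par_in: "x \<in> V \<Longrightarrow> par x \<in> V"
    and dep_par: "x \<in> V \<Longrightarrow> dep (par x) = dep x - 1"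
    and dep_0_iff: "x \<in> V \<Longrightarrow> dep x = 0 \<longleftrightarrow> x = apex"
begin

lemma anc_in: "x \<in> V \<Longrightarrow> (par ^^ i) x \<in> V"
  by (induction i) (auto intro: par_in)

lemma dep_anc: "x \<in> V \<Longrightarrow> dep ((par ^^ i) x) = dep x - i"
  by (induction i) (auto simp: dep_par anc_in)

lemma anc_eq_apex_iff: "x \<in> V \<Longrightarrow> (par ^^ i) x = apex \<longleftrightarrow> dep x \<le> i"
  using dep_0_iff[OF anc_in, of x i] by (auto simp: dep_anc)

lemma inj_on_anc:
  assumes "x \<in> V" "\<And>i. i \<in> I \<Longrightarrow> i \<le> dep x"
  shows "inj_on (\<lambda>i. (par ^^ i) x) I"
proof (rule inj_onI)
  fix i j assume ij: "i \<in> I" "j \<in> I" "(par ^^ i) x = (par ^^ j) x"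
  then have "dep x - i = dep x - j"
    using dep_anc[OF assms(1), of i] dep_anc[OF assms(1), of j] by simp
  then show "i = j"
    using assms(2)[OF ij(1)] assms(2)[OF ij(2)] by linarith
qed

section \<open>Covering and packing\<close>

text \<open>
  The greedy step: a vertex \<open>x\<close> no deeper than \<open>u\<close> that escapes the ball of radius \<open>r\<close> about the \<open>r\<close>-th
  ancestor \<open>v\<close> of \<open>u\<close> is at distance more than \<open>2 r\<close> from \<open>u\<close>. If the path from \<open>u\<close> to \<open>x\<close> passes through
  \<open>v\<close>, then \<open>x\<close> is \<open>r\<close> closer to \<open>v\<close> than to \<open>u\<close>. Otherwise it turns at an ancestor of \<open>u\<close> below \<open>v\<close>, and
  as \<open>x\<close> is no deeper than \<open>u\<close>, it is no farther from \<open>v\<close> than \<open>u\<close> is, so it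
  does not escape.
\<close>

lemma near_deepest:
  assumes u: "u \<in> V" and x: "x \<in> V" and deep: "dep x \<le> dep u"
    and near: "near par (2 * r) u x"
  shows "near par r ((par ^^ r) u) x"
proof -
  obtain i j where ij: "i + j \<le> 2 * r" "(par ^^ i) u = (par ^^ j) x"
    using near unfolding near_def by blast
  consider "r \<le> i" | "i < r" "j \<le> i" | "i < r" "i < j" by linarith
  then show ?thesis
  proof cases
    case 1
    have "(par ^^ (i - r)) ((par ^^ r) u) = (par ^^ (i - r + r)) u"
      by (simp only: funpow_add o_apply)
    then have "(par ^^ (i - r)) ((par ^^ r) u) = (par ^^ j) x"
      using 1 ij by simp
    then show ?thesis by (rule nearI) (use 1 ij in linarith)
  next
    case 2
    have "(par ^^ r) u = (par ^^ (r - i + i)) u" using 2 by simp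
    also have "\<dots> = (par ^^ (r - i)) ((par ^^ i) u)" by (simp only: funpow_add o_apply)
    also have "\<dots> = (par ^^ (r - i + j)) x" using ij by (simp add: funpow_add)
    finally have "(par ^^ 0) ((par ^^ r) u) = (par ^^ (r - i + j)) x" by simp
    then show ?thesis by (rule nearI) (use 2 in linarith)
  next
    case 3
    \<comment> \<open>As \<open>x\<close> is no deeper than \<open>u\<close>, the climbs of unequal length can only meet at the root, where
      truncated subtraction makes both depth differences zero.\<close>
    have "dep u - i = dep x - j" using dep_anc[OF u, of i] dep_anc[OF x, of j] ij by simp
    then have "dep u \<le> r" "dep x \<le> r" using 3 deep by linarith+
    then have "(par ^^ 0) ((par ^^ r) u) = (par ^^ r) x"
      using anc_eq_apex_iff[OF u, of r] anc_eq_apex_iff[OF x, of r] by simp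
    then show ?thesis by (rule nearI) simp
  qed
qed

definition separated :: "nat \<Rightarrow> 'a set \<Rightarrow> bool" where
  "separated t P \<longleftrightarrow> (\<forall>p\<in>P. \<forall>q\<in>P. p \<noteq> q \<longrightarrow> \<not> near par t p q)"

text \<open>
  Induction removes from \<open>X\<close> the ball that covers its deepest vertex \<open>u\<close>; the centre of that
  ball joins the cover, and \<open>u\<close> joins the packing.
\<close>

lemma cover_packing_on:
  assumes "X \<subseteq> V"
  shows "\<exists>S P. S \<subseteq> V \<and> P \<subseteq> X \<and> card S \<le> card P \<and> separated (2 * r) P \<and>
           (\<forall>x\<in>X. \<exists>s\<in>S. near par r s x)"
  using finite_subset[OF assms finite_V] assms
proof (induction X rule: finite_psubset_induct)
  case (psubset X)
  show ?case
  proof (cases "X = {}")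
    case True
    then show ?thesis by (intro exI[of _ "{}"]) (simp add: separated_def)
  next
    case False
    then have "Max (dep ` X) \<in> dep ` X" using psubset by simp
    then obtain u where u: "u \<in> X" "dep u = Max (dep ` X)" by auto
    have deepest: "dep x \<le> dep u" if "x \<in> X" for x
      using that u psubset by simp
    have uV: "u \<in> V" using u psubset by blast
    define v where "v = (par ^^ r) u"
    define Y where "Y = {x\<in>X. \<not> near par r v x}"
    have "near par r v u" unfolding v_def by (rule nearI[of 0 _ _ r]) auto
    then have "Y \<subset> X" using u unfolding Y_def by blast
    then have "Y \<subseteq> V" using psubset.prems by blast
    from psubset.IH[OF \<open>Y \<subset> X\<close> this] obtain S P
      where SP: "S \<subseteq> V \<and> P \<subseteq> Y \<and> card S \<le> card P \<and> separated (2 * r) P \<and>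
        (\<forall>x\<in>Y. \<exists>s\<in>S. near par r s x)"
      by (elim exE) (rule that)
    from SP have SV: "S \<subseteq> V" and PY: "P \<subseteq> Y" and le: "card S \<le> card P"
      and sep: "separated (2 * r) P" and cov: "\<forall>x\<in>Y. \<exists>s\<in>S. near par r s x"
      by simp_all
    have far: "\<not> near par (2 * r) u x" if x: "x \<in> P" for x
    proof
      assume "near par (2 * r) u x"
      have "x \<in> X" and away: "\<not> near par r v x" using x PY unfolding Y_def by auto
      then have "x \<in> V" using psubset.prems by auto
      have "near par r v x"
        unfolding v_def
        by (rule near_deepest[OF uV \<open>x \<in> V\<close> deepest[OF \<open>x \<in> X\<close>]]) fact
      with away show False by contradiction
    qed
    have far': "\<not> near par (2 * r) x u" if x: "x \<in> P" for x
      using far[OF x] near_sym[of par "2 * r" x u] by blast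
    have "u \<notin> P" using far[of u] nearI[of 0 par u 0 u "2 * r"] by auto
    have "P \<subseteq> X" using PY \<open>Y \<subset> X\<close> by auto
    have "finite P" "finite S"
      using finite_subset[OF \<open>P \<subseteq> X\<close> psubset.hyps(1)] finite_subset[OF SV finite_V] by auto
    have "card (insert v S) \<le> card (insert u P)"
      using \<open>u \<notin> P\<close> \<open>finite P\<close> \<open>finite S\<close> le by (simp add: card_insert_if)
    moreover have "insert v S \<subseteq> V" unfolding v_def using SV anc_in[OF uV] by auto
    moreover have "separated (2 * r) (insert u P)"
      using sep far far' unfolding separated_def by auto
    moreover have "\<forall>x\<in>X. \<exists>s\<in>insert v S. near par r s x"
    proof
      fix x assume "x \<in> X"
      then show "\<exists>s\<in>insert v S. near par r s x"
        using cov by (cases "near par r v x") (auto simp: Y_def)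
    qed
    moreover have "insert u P \<subseteq> X" using \<open>P \<subseteq> X\<close> u(1) by auto
    ultimately show ?thesis
      by (intro exI[of _ "insert v S"] exI[of _ "insert u P"] conjI)
  qed
qed

definition covers :: "nat \<Rightarrow> 'a set \<Rightarrow> bool" where
  "covers t S \<longleftrightarrow> S \<subseteq> V \<and> S \<noteq> {} \<and> (\<forall>x\<in>V. \<exists>s\<in>S. near par t s x)"

lemma cover_packing:
  "\<exists>S P. covers r S \<and> P \<subseteq> V \<and> card S \<le> card P \<and> separated (2 * r) P"
proof -
  obtain S P where *: "S \<subseteq> V \<and> P \<subseteq> V \<and> card S \<le> card P \<and> separated (2 * r) P \<and>
      (\<forall>x\<in>V. \<exists>s\<in>S. near par r s x)"
    using cover_packing_on[OF order_refl, of r] by (elim exE) (rule that)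
  moreover have "S \<noteq> {}" using * apex_in by auto
  ultimately show ?thesis unfolding covers_def by (intro exI[of _ S] exI[of _ P]) simp
qed

definition ball :: "nat \<Rightarrow> 'a \<Rightarrow> 'a set" where
  "ball r p = {x\<in>V. near par r p x}"

lemma finite_ball: "finite (ball r p)"
  unfolding ball_def using finite_V by simp

lemma separated_disjoint_balls:
  assumes "separated (2 * r) P" "p \<in> P" "q \<in> P" "p \<noteq> q"
  shows "ball r p \<inter> ball r q = {}"
proof -
  have "near par (2 * r) p q" if "near par r p x" "near par r q x" for x
    using near_trans[OF that(1) near_sym[OF that(2)]] by (simp add: mult_2)
  then show ?thesis using assms unfolding separated_def ball_def by blast
qed

text \<open>
  Ball sizes can be bounded from below only for centres with \<open>r\<close> proper ancestors. At most one centre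
  has fewer, since two of them would meet at the root.
\<close>

lemma separated_shallow:
  assumes "separated (2 * r) P" "P \<subseteq> V"
  shows "card P \<le> card {p\<in>P. r \<le> dep p} + 1"
proof -
  define Q where "Q = {p\<in>P. dep p < r}"
  have "finite P" using assms finite_V finite_subset by blast
  have "p = q" if "p \<in> Q" "q \<in> Q" for p q
  proof (rule ccontr)
    assume "p \<noteq> q"
    have "(par ^^ r) p = (par ^^ r) q"
      using that assms anc_eq_apex_iff[of p r] anc_eq_apex_iff[of q r] unfolding Q_def by (auto simp: subset_iff)
    then have "near par (2 * r) p q" by (rule nearI) simp
    then show False using that assms \<open>p \<noteq> q\<close> unfolding Q_def separated_def by blast
  qed
  then have "card Q \<le> 1"
    using card_le_Suc0_iff_eq[of Q] \<open>finite P\<close> unfolding Q_def by simp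
  moreover have "P = {p\<in>P. r \<le> dep p} \<union> Q" unfolding Q_def by auto
  then have "card P \<le> card {p\<in>P. r \<le> dep p} + card Q" by (metis card_Un_le)
  ultimately show ?thesis by linarith
qed

text \<open>
  Double counting over disjoint balls, with two weights so that one application counts all
  vertices and, a second time, those outside the core.
\<close>

lemma packing_bound:
  assumes "separated (2 * r) P" "P \<subseteq> V"
    and big: "\<And>p. p \<in> V \<Longrightarrow> r \<le> dep p \<Longrightarrow> m \<le> card (ball r p \<inter> A) + card (ball r p \<inter> B)"
  shows "m * (card P - 1) \<le> card (V \<inter> A) + card (V \<inter> B)"
proof -
  define Q where "Q = {p\<in>P. r \<le> dep p}"
  have "finite Q" unfolding Q_def using assms finite_V finite_subset by fastforce
  have sum: "(\<Sum>p\<in>Q. card (ball r p \<inter> C)) \<le> card (V \<inter> C)" for C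
  proof -
    have "(\<Sum>p\<in>Q. card (ball r p \<inter> C)) = card (\<Union>p\<in>Q. ball r p \<inter> C)"
    proof (rule card_UN_disjoint[symmetric])
      show "\<forall>p\<in>Q. \<forall>q\<in>Q. p \<noteq> q \<longrightarrow> ball r p \<inter> C \<inter> (ball r q \<inter> C) = {}"
        using separated_disjoint_balls[OF assms(1)] unfolding Q_def by blast
    qed (use \<open>finite Q\<close> finite_ball in auto)
    also have "\<dots> \<le> card (V \<inter> C)"
      by (rule card_mono) (use finite_V in \<open>auto simp: ball_def\<close>)
    finally show ?thesis .
  qed
  have "m * (card P - 1) \<le> m * card Q"
    using separated_shallow[OF assms(1,2)] unfolding Q_def by (intro mult_le_mono2) linarith
  also have "\<dots> = (\<Sum>p\<in>Q. m)" by simp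
  also have "\<dots> \<le> (\<Sum>p\<in>Q. card (ball r p \<inter> A) + card (ball r p \<inter> B))"
    using assms(2) by (intro sum_mono big) (auto simp: Q_def)
  also have "\<dots> \<le> card (V \<inter> A) + card (V \<inter> B)"
    unfolding sum.distrib using sum[of A] sum[of B] by linarith
  finally show ?thesis .
qed

lemma ancestors_in_ball:
  assumes "p \<in> V"
  shows "(\<lambda>i. (par ^^ i) p) ` {..r} \<subseteq> ball r p"
proof -
  have "near par r p ((par ^^ i) p)" if "i \<le> r" for i
    using that by (intro nearI[of i _ _ 0]) auto
  then show ?thesis unfolding ball_def using anc_in[OF assms] by auto
qed

lemma card_ancestors:
  assumes "p \<in> V" "r \<le> dep p"
  shows "card ((\<lambda>i. (par ^^ i) p) ` {..r}) = r + 1"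
  using card_image[OF inj_on_anc[OF assms(1), of "{..r}"]] assms(2) by auto

lemma packing_bound_simple:
  assumes "separated (2 * r) P" "P \<subseteq> V"
  shows "(r + 1) * (card P - 1) \<le> card V"
proof -
  have "r + 1 \<le> card (ball r p \<inter> UNIV) + card (ball r p \<inter> {})" if "p \<in> V" "r \<le> dep p" for p
    using card_mono[OF finite_ball ancestors_in_ball[OF that(1), of r]] card_ancestors[OF that]
    by simp
  from packing_bound[OF assms this] show ?thesis by simp
qed

section \<open>Trimming the tree\<close>

text \<open>
  The vertices with a descendant exactly \<open>r\<close> levels below, together with the root: the tree after
  its leaves have been removed \<open>r\<close> times.
\<close>

definition core :: "nat \<Rightarrow> 'a set" where
  "core r = (par ^^ r) ` V"

lemma core_subset: "core r \<subseteq> V"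
  unfolding core_def using anc_in by blast

lemma rooted_tree_core: "rooted_tree (core r) apex par dep"
proof
  show "finite (core r)" unfolding core_def using finite_V by simp
  have "(par ^^ r) apex = apex"
    using anc_eq_apex_iff[OF apex_in, of r] dep_0_iff[OF apex_in] by simp
  then show "apex \<in> core r"
    unfolding core_def using apex_in by (intro image_eqI[of _ _ apex]) simp_all
  show "par x \<in> core r" if x: "x \<in> core r" for x
  proof -
    obtain y where "y \<in> V" "x = (par ^^ r) y"
      using x unfolding core_def by blast
    then have "par x = (par ^^ r) (par y)" by (simp only: funpow_swap1[of par r y])
    then show ?thesis
      unfolding core_def using \<open>y \<in> V\<close> by (intro image_eqI[of _ _ "par y"] par_in)
  qed
  show "dep (par x) = dep x - 1" "dep x = 0 \<longleftrightarrow> x = apex" if "x \<in> core r" for x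
    using that core_subset[of r] dep_par[of x] dep_0_iff[of x] by auto
qed

text \<open>
  Let \<open>d\<close> be the distance from \<open>p\<close> up to the core. The first \<open>d\<close> vertices on the way lie outside the core,
  so it remains to find \<open>2 r + 1 - d\<close> vertices in the ball. The \<open>r\<close> nearest ancestors and \<open>p\<close> itself account
  for \<open>r + 1\<close>. For \<open>m = r - d\<close> further ones, use that the \<open>d\<close>-th ancestor of \<open>p\<close> has
  a descendant \<open>y\<close> at relative depth \<open>r = m + d\<close>. The descending path to \<open>y\<close> may at first run along the
  path to \<open>p\<close>; it leaves that path at the \<open>i\<close>-th ancestor of \<open>p\<close> for some \<open>i \<le> d\<close>, from where it
  still descends \<open>m + i\<close> levels. The first \<open>m\<close> of them are at distance at most \<open>i + m \<le> r\<close> from \<open>p\<close>.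
\<close>

lemma ball_count:
  assumes p: "p \<in> V" and deep: "r \<le> dep p"
  shows "2 * r + 1 \<le> card (ball r p) + card (ball r p - core r)"
proof -
  let ?up = "\<lambda>i. (par ^^ i) p"
  define d where "d = (LEAST i. ?up i \<in> core r)"
  have r_core: "?up r \<in> core r" unfolding core_def using p by blast
  have d_core: "?up d \<in> core r" unfolding d_def by (rule LeastI) (rule r_core)
  have d_le: "d \<le> r" unfolding d_def by (rule Least_le) (rule r_core)
  have below: "?up i \<notin> core r" if "i < d" for i
    using that unfolding d_def by (rule not_less_Least)
  have "?up ` {..<d} \<subseteq> ball r p - core r"
    using ancestors_in_ball[OF p, of r] below d_le by auto
  moreover have "card (?up ` {..<d}) = d"
    using d_le deep by (subst card_image[OF inj_on_anc[OF p]]) auto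
  ultimately have outside: "d \<le> card (ball r p - core r)"
    by (metis card_mono finite_Diff finite_ball)

  define m where "m = r - d"
  have "\<exists>Z. Z \<subseteq> ball r p \<and> Z \<inter> ?up ` {..r} = {} \<and> card Z = m"
  proof (cases "m = 0")
    case True
    then show ?thesis by (intro exI[of _ "{}"]) simp
  next
    case False
    \<comment> \<open>The branching point is the first ancestor of \<open>p\<close> from which one can descend to the level
      that lies \<open>m\<close> below \<open>p\<close>.\<close>
    define good where "good i \<longleftrightarrow> (\<exists>y\<in>V. ?up i = (par ^^ (m + i)) y)" for i
    have "good d" using d_core d_le unfolding good_def m_def core_def by auto
    define i where "i = (LEAST i. good i)"
    have "good i" "i \<le> d" unfolding i_def using \<open>good d\<close> by (auto intro: LeastI Least_le)
    have least: "\<not> good k" if "k < i" for k using that unfolding i_def by (rule not_less_Least)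
    obtain y where y: "y \<in> V" "?up i = (par ^^ (m + i)) y"
      using \<open>good i\<close> unfolding good_def by blast
    have "dep p - i = dep y - (m + i)" using dep_anc[OF p, of i] dep_anc[OF y(1), of "m + i"] y by simp
    \<comment> \<open>The truncated differences are positive here: \<open>m > 0\<close> means \<open>d < r\<close>, so the branching point is
      not the root.\<close>
    then have dep_y: "dep y = dep p + m"
      using False \<open>i \<le> d\<close> d_le deep unfolding m_def by linarith
    let ?Z = "(\<lambda>j. (par ^^ j) y) ` {i..<m + i}"
    have "near par r p ((par ^^ j) y)" if "j \<in> {i..<m + i}" for j
    proof (rule nearI[of i _ _ "m + i - j"])
      have "(par ^^ (m + i - j)) ((par ^^ j) y) = (par ^^ (m + i - j + j)) y"
        by (simp only: funpow_add o_apply)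
      then show "?up i = (par ^^ (m + i - j)) ((par ^^ j) y)" using that y by simp
      show "i + (m + i - j) \<le> r" using that \<open>i \<le> d\<close> d_le unfolding m_def by auto
    qed
    then have "?Z \<subseteq> ball r p" unfolding ball_def using anc_in[OF y(1)] by auto
    moreover have "?Z \<inter> ?up ` {..r} = {}"
    proof -
      have False if "j \<in> {i..<m + i}" "k \<le> r" "(par ^^ j) y = ?up k" for j k
      proof -
        have "dep p + m - j = dep p - k"
          using dep_anc[OF p, of k] dep_anc[OF y(1), of j] that dep_y by simp
        then have "j = m + k" using that \<open>i \<le> d\<close> d_le deep unfolding m_def by auto
        then have "good k" using that y unfolding good_def by metis
        then show False using least[of k] \<open>j = m + k\<close> that by auto
      qed
      then show ?thesis by fastforce
    qed
    moreover have "card ?Z = m"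
      using dep_y \<open>i \<le> d\<close> d_le deep by (subst card_image[OF inj_on_anc[OF y(1)]]) auto
    ultimately show ?thesis by blast
  qed
  then obtain Z where Z: "Z \<subseteq> ball r p" "Z \<inter> ?up ` {..r} = {}" "card Z = m" by blast
  have "finite Z" using Z finite_ball finite_subset by blast
  then have "card (?up ` {..r} \<union> Z) = r + 1 + m"
    using Z card_ancestors[OF p deep] by (subst card_Un_disjoint) auto
  moreover have "?up ` {..r} \<union> Z \<subseteq> ball r p" using Z ancestors_in_ball[OF p] by blast
  ultimately have "r + 1 + m \<le> card (ball r p)" by (metis card_mono finite_ball)
  with outside d_le show ?thesis unfolding m_def by linarith
qed

lemma packing_bound_core:
  assumes "separated (2 * r) P" "P \<subseteq> V"
  shows "(2 * r + 1) * (card P - 1) + card (core r) \<le> 2 * card V"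
proof -
  have "2 * r + 1 \<le> card (ball r p \<inter> UNIV) + card (ball r p \<inter> - core r)"
    if "p \<in> V" "r \<le> dep p" for p
    using ball_count[OF that] by (simp add: Diff_eq)
  from packing_bound[OF assms this]
  have "(2 * r + 1) * (card P - 1) \<le> card V + card (V - core r)" by (simp add: Diff_eq)
  moreover have "card (V - core r) = card V - card (core r)" "card (core r) \<le> card V"
    using core_subset[of r] finite_V by (auto intro: card_Diff_subset card_mono finite_subset)
  ultimately show ?thesis by linarith
qed

lemma cover_one_scale:
  obtains S where "covers r S" "(2 * r + 1) * (card S - 1) + card (core r) \<le> 2 * card V"
proof -
  obtain S P where "covers r S \<and> P \<subseteq> V \<and> card S \<le> card P \<and> separated (2 * r) P"
    using cover_packing[of r] by (elim exE) (rule that)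
  then have *: "covers r S" "P \<subseteq> V" "card S \<le> card P" "separated (2 * r) P" by simp_all
  have "(2 * r + 1) * (card S - 1) \<le> (2 * r + 1) * (card P - 1)"
    using *(3) by (intro mult_le_mono2) linarith
  then have "(2 * r + 1) * (card S - 1) + card (core r) \<le> 2 * card V"
    by (rule order_trans[OF add_right_mono packing_bound_core[OF *(4,2)]])
  with *(1) show ?thesis by (rule that)
qed

lemma cover_two_scales:
  obtains S where "covers (r + s) S" "(s + 1) * (card S - 1) \<le> card (core r)"
proof -
  interpret core: rooted_tree "core r" apex par dep by (rule rooted_tree_core)
  obtain S P
    where "core.covers s S \<and> P \<subseteq> core r \<and> card S \<le> card P \<and> core.separated (2 * s) P"
    using core.cover_packing[of s] by (elim exE) (rule that)
  then have *: "core.covers s S" "P \<subseteq> core r" "card S \<le> card P" "core.separated (2 * s) P"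
    by simp_all
  have covered: "\<exists>z\<in>S. near par (r + s) z x" if x: "x \<in> V" for x
  proof -
    have "(par ^^ r) x \<in> core r" unfolding core_def using x by blast
    then obtain z where z: "z \<in> S" "near par s z ((par ^^ r) x)"
      using *(1) unfolding core.covers_def by blast
    have "near par r ((par ^^ r) x) x" by (rule nearI[of 0 _ _ r]) auto
    from near_trans[OF z(2) this] z(1) show ?thesis by (auto simp: add.commute)
  qed
  have "(s + 1) * (card S - 1) \<le> (s + 1) * (card P - 1)"
    using *(3) by (intro mult_le_mono2) linarith
  then have few: "(s + 1) * (card S - 1) \<le> card (core r)"
    by (rule order_trans[OF _ core.packing_bound_simple[OF *(4,2)]])
  have "S \<subseteq> V" "S \<noteq> {}"
    using *(1) core_subset[of r] unfolding core.covers_def by auto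
  then have "covers (r + s) S" using covered unfolding covers_def by simp
  then show ?thesis using few by (rule that)
qed

section \<open>Choosing the radii\<close>

text \<open>
  The radii solve the optimisation problem over the threshold for the core. With \<open>q = \<surd>n\<close>, a core of
  more than \<open>(2/7) q\<^sup>2\<close> vertices leaves at most \<open>(12/7) q\<^sup>2 / (2 r) = (4 c / 7) q\<close> balls of radius
  \<open>(3 c / 7) q\<close>; a smaller core is covered by \<open>(2/7) q\<^sup>2 / s = (2 c / 7) q\<close> balls of radius \<open>s\<close>. The
  constant absorbs the rounding of \<open>r\<close> and \<open>s\<close> and the ball of the one centre near the root.
\<close>

lemma cover_sqrt_bound:
  "\<exists>t S. covers t S \<and> real (card S + t) \<le> sqrt 14 / 2 * sqrt (real (card V)) + 3"
proof -
  define n where "n = card V"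
  define q where "q = sqrt (real n)"
  define c where "c = sqrt 14 / 2"
  define r where "r = nat \<lceil>3 * c / 7 * q\<rceil>"
  define s where "s = nat \<lceil>2 * c / 7 * q\<rceil>"
  have "n > 0" unfolding n_def using apex_in finite_V card_gt_0_iff by blast
  then have q: "q > 0" "q * q = real n" unfolding q_def by auto
  have c: "c > 0" "c * c = 7 / 2" unfolding c_def by (auto simp: field_simps)
  have r: "3 * c / 7 * q \<le> real r" "real r \<le> 3 * c / 7 * q + 1"
    using real_nat_ceiling_ge[of "3 * c / 7 * q"] q(1) c(1)
      of_int_ceiling_le_add_one[of "3 * c / 7 * q"]
    unfolding r_def by simp_all
  have s: "2 * c / 7 * q \<le> real s" "real s \<le> 2 * c / 7 * q + 1"
    using real_nat_ceiling_ge[of "2 * c / 7 * q"] q(1) c(1)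
      of_int_ceiling_le_add_one[of "2 * c / 7 * q"]
    unfolding s_def by simp_all
  show ?thesis
  proof (cases "7 * card (core r) \<le> 2 * n")
    case True
    obtain S where S: "covers (r + s) S" "(s + 1) * (card S - 1) \<le> card (core r)"
      using cover_two_scales by blast
    define k where "k = real (card S - 1)"
    have "(2 * c / 7 * q) * k \<le> real (s + 1) * k"
      using s unfolding k_def by (intro mult_right_mono) auto
    also have "\<dots> \<le> real (card (core r))" using S(2) unfolding k_def by (metis of_nat_le_iff of_nat_mult)
    also have "\<dots> \<le> 2 / 7 * (q * q)" using True q by simp
    also have "\<dots> = (2 * c / 7 * q) * (2 * c / 7 * q)" using c(2) by algebra
    finally have "k \<le> 2 * c / 7 * q" using q c by (simp add: mult_le_cancel_left_pos)
    then have "real (card S + (r + s)) \<le> c * q + 3"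
      using r s unfolding k_def by (simp add: of_nat_diff field_simps)
    then show ?thesis using S(1) unfolding c_def q_def n_def by blast
  next
    case False
    obtain S where S: "covers r S" "(2 * r + 1) * (card S - 1) + card (core r) \<le> 2 * card V"
      using cover_one_scale by blast
    define k where "k = real (card S - 1)"
    have "real (2 * r + 1) * k + real (card (core r)) \<le> 2 * (q * q)"
      using S(2) q unfolding k_def n_def
      by (metis of_nat_add of_nat_le_iff of_nat_mult of_nat_numeral)
    moreover have "2 * real n < 7 * real (card (core r))" using False by linarith
    moreover have "(6 * c / 7 * q) * k \<le> real (2 * r + 1) * k"
      using r unfolding k_def by (intro mult_right_mono) auto
    ultimately have "(6 * c / 7 * q) * k \<le> 12 / 7 * (q * q)" using q by linarith
    also have "\<dots> = (6 * c / 7 * q) * (4 * c / 7 * q)" using c(2) by algebra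
    finally have "k \<le> 4 * c / 7 * q" using q c by (simp add: mult_le_cancel_left_pos)
    then have "real (card S + r) \<le> c * q + 3"
      using r unfolding k_def by (simp add: of_nat_diff field_simps)
    then show ?thesis using S(1) unfolding c_def q_def n_def by blast
  qed
qed

end

section \<open>Breadth-first parents in connected graphs\<close>

text \<open>
  A vertex other than the root has a neighbour one step closer to it, the last but one vertex of a
  shortest walk.
\<close>

lemma (in graph) obtain_rooted_tree:
  assumes "Digraph_Component.connected G"
  obtains apex par dep where "rooted_tree (verts G) apex par dep"
    "\<forall>x\<in>verts G. par x = x \<or> par x \<rightarrow>\<^bsub>G\<^esub> x"
proof -
  let ?E = "arcs_ends G"
  have sc: "strongly_connected G"
    using symmetric_connected_imp_strongly_connected[OF sym_arcs assms] .
  then obtain apex where apex: "apex \<in> verts G" unfolding strongly_connected_def by blast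
  define dep where "dep x = (LEAST k. (apex, x) \<in> ?E ^^ k)" for x
  have dep: "(apex, x) \<in> ?E ^^ dep x" if "x \<in> verts G" for x
  proof -
    have "apex \<rightarrow>\<^sup>* x" using sc apex that unfolding strongly_connected_def by blast
    then have "(apex, x) \<in> ?E\<^sup>*" by (rule reachable_rtranclI)
    then show ?thesis unfolding dep_def by (metis LeastI_ex rtrancl_imp_relpow)
  qed
  have dep_le: "dep x \<le> k" if "(apex, x) \<in> ?E ^^ k" for x k
    unfolding dep_def using that by (rule Least_le)
  have dep_apex: "dep apex = 0" using dep_le[of apex 0] by simp
  have ex: "\<exists>y. y \<in> verts G \<and> y \<rightarrow> x \<and> dep y = dep x - 1" if x: "x \<in> verts G" "dep x \<noteq> 0" for x
  proof -
    obtain k where k: "dep x = Suc k" using x not0_implies_Suc by blast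
    then obtain y where y: "(apex, y) \<in> ?E ^^ k" "y \<rightarrow> x" using dep[OF x(1)] by auto
    then have "y \<in> verts G" using adj_in_verts by blast
    then have "(apex, x) \<in> ?E ^^ Suc (dep y)" using dep y by auto
    then have "dep x \<le> Suc (dep y)" by (rule dep_le)
    then have "dep y = k" using dep_le[OF y(1)] k by linarith
    then show ?thesis using k y \<open>y \<in> verts G\<close> by auto
  qed
  define par where "par x = (if dep x = 0 then x else SOME y. y \<in> verts G \<and> y \<rightarrow> x \<and> dep y = dep x - 1)" for x
  have par: "par x \<in> verts G \<and> par x \<rightarrow> x \<and> dep (par x) = dep x - 1"
    if "x \<in> verts G" "dep x \<noteq> 0" for x
    using someI_ex[OF ex[OF that]] that unfolding par_def by simp
  have par0: "par x = x" if "dep x = 0" for x using that unfolding par_def by simp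
  have "rooted_tree (verts G) apex par dep"
  proof
    show "par x \<in> verts G" if "x \<in> verts G" for x
      using that par par0 by metis
    show "dep (par x) = dep x - 1" if "x \<in> verts G" for x
      using that par par0 by (metis diff_0_eq_0)
    show "dep x = 0 \<longleftrightarrow> x = apex" if "x \<in> verts G" for x
      using dep[OF that] dep_apex by auto
  qed (use apex in auto)
  moreover have "\<forall>x\<in>verts G. par x = x \<or> par x \<rightarrow> x"
    using par par0 by metis
  ultimately show ?thesis by (rule that)
qed

section \<open>Positive semidefinite forcing on trees\<close>

lemma induce_subgraph_dominates_iff:
  "u \<rightarrow>\<^bsub>G \<restriction> X\<^esub> v \<longleftrightarrow> u \<rightarrow>\<^bsub>G\<^esub> v \<and> u \<in> X \<and> v \<in> X"
  by (auto simp: arcs_ends_conv)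

text \<open>
  If \<open>v\<close> had a second neighbour \<open>x\<close> in the white component of \<open>w\<close>, then a white path from \<open>w\<close> to \<open>x\<close>
  would form with \<open>v\<close> a cycle of length at least 3.
\<close>

lemma tree_neighbour_forced:
  assumes tree: "undirected_tree G" and S: "S \<subseteq> verts G" "v \<in> S" and w: "w \<notin> S" "v \<rightarrow>\<^bsub>G\<^esub> w"
  shows "psd_forces G S v w"
proof -
  interpret graph G using tree unfolding undirected_tree_def by blast
  let ?H = "G \<restriction> (verts G - S)"
  interpret H: wf_digraph ?H by blast
  define W where "W = H.scc_of w"
  have "w \<in> verts ?H" using w adj_in_verts by auto
  then have wW: "w \<in> W" and W: "W \<in> white_components G S"
    unfolding W_def white_components_def
    by (auto intro: H.in_scc_of_self H.scc_of_in_sccs_verts)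
  have unique: "x = w" if x: "x \<notin> S" "v \<rightarrow>\<^bsub>G \<restriction> (W \<union> S)\<^esub> x" for x
  proof (rule ccontr)
    assume "x \<noteq> w"
    have "x \<in> W" "v \<rightarrow>\<^bsub>G\<^esub> x" using x by (auto simp: induce_subgraph_dominates_iff)
    then obtain p where p: "H.apath w p x"
      unfolding W_def H.scc_of_def using H.reachable_apath by blast
    have "p \<noteq> []" using p \<open>x \<noteq> w\<close> by (auto simp: H.apath_Nil_iff)
    obtain e where e: "e \<in> arcs G" "tail G e = v" "head G e = w" using w by blast
    have "x \<rightarrow>\<^bsub>G\<^esub> v" using \<open>v \<rightarrow>\<^bsub>G\<^esub> x\<close> sym_arcs by (rule arcs_ends_symmetric[rotated])
    then obtain f where f: "f \<in> arcs G" "tail G f = x" "head G f = v" by blast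
    have "subgraph ?H G" by (rule subgraph_induce_subgraphI) auto
    then have pG: "awalk w p x" using p subgraph_awalk_imp_awalk unfolding H.apath_def by blast
    have verts_eq: "awalk_verts w p = H.awalk_verts w p"
      by (simp add: awalk_verts_conv H.awalk_verts_conv)
    have avoid: "set (awalk_verts w p) \<subseteq> verts G - S"
      using p verts_eq unfolding H.apath_def H.awalk_conv by simp
    have "awalk v (e # p @ [f]) v"
      using e f pG head_in_verts[OF f(1)] by (simp add: awalk_Cons_iff awalk_Nil_iff)
    moreover have "awalk_verts w (p @ [f]) = awalk_verts w p @ [v]"
      using \<open>p \<noteq> []\<close> pG f by (auto simp: awalk_verts_conv)
    then have "distinct (tl (awalk_verts v (e # p @ [f])))"
      using p verts_eq avoid S(2) e unfolding H.apath_def by auto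
    ultimately have "cycle (e # p @ [f])" unfolding cycle_def by blast
    moreover have "3 \<le> length (e # p @ [f])" using \<open>p \<noteq> []\<close> by (cases p) auto
    ultimately show False using tree unfolding undirected_tree_def by blast
  qed
  have "v \<rightarrow>\<^bsub>G \<restriction> (W \<union> S)\<^esub> w"
    using w wW S by (simp add: induce_subgraph_dominates_iff)
  then have "{x. x \<notin> S \<and> v \<rightarrow>\<^bsub>G \<restriction> (W \<union> S)\<^esub> x} = {w}"
    using w(1) unique by blast
  then have "\<exists>W\<in>white_components G S. {x. x \<notin> S \<and> v \<rightarrow>\<^bsub>G \<restriction> (W \<union> S)\<^esub> x} = {w}"
    using W by (rule bexI)
  with S(2) show ?thesis unfolding psd_forces_def by (rule conjI)
qed

lemma psd_round_mono: "S \<subseteq> psd_round G S"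
  unfolding psd_round_def by blast

lemma psd_round_subset:
  assumes "wf_digraph G" "S \<subseteq> verts G"
  shows "psd_round G S \<subseteq> verts G"
proof -
  interpret wf_digraph G by fact
  have "w \<in> verts G" if "psd_forces G S v w" for v w
  proof -
    from that obtain W where "v \<rightarrow>\<^bsub>G \<restriction> (W \<union> S)\<^esub> w" unfolding psd_forces_def by blast
    then have "v \<rightarrow>\<^bsub>G\<^esub> w" by (simp add: induce_subgraph_dominates_iff)
    then show ?thesis by (rule adj_in_verts)
  qed
  then show ?thesis unfolding psd_round_def using assms by blast
qed

lemma psd_rounds_subset:
  assumes "wf_digraph G" "S \<subseteq> verts G"
  shows "(psd_round G ^^ t) S \<subseteq> verts G"
  by (induction t) (use assms in \<open>simp_all add: psd_round_subset\<close>)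

lemma psd_rounds_mono:
  assumes "s \<le> t"
  shows "(psd_round G ^^ s) S \<subseteq> (psd_round G ^^ t) S"
  by (rule lift_Suc_mono_le[of "\<lambda>t. (psd_round G ^^ t) S", OF _ assms]) (simp add: psd_round_mono)

lemma th_plus_le:
  assumes "S \<subseteq> verts G" "S \<noteq> {}" "finite S" "(psd_round G ^^ t) S = verts G"
  shows "th_plus G \<le> enat (card S + t)"
proof -
  have "pt_plus G (card S) \<le> enat t"
    unfolding pt_plus_def using assms by (intro Inf_lower) blast
  moreover have "th_plus G \<le> enat (card S) + pt_plus G (card S)"
    unfolding th_plus_def using assms card_gt_0_iff[of S] by (intro INF_lower) auto
  ultimately show ?thesis
    by (metis add_left_mono order_trans plus_enat_simps(1))
qed

text \<open>
  The colouring advances along the path from \<open>s\<close> to \<open>x\<close> by one edge per round, climbing to the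
  common ancestor and then descending.
\<close>

lemma tree_near_forced:
  assumes tree: "undirected_tree G" and rt: "rooted_tree (verts G) apex par dep"
    and par: "\<And>x. x \<in> verts G \<Longrightarrow> par x = x \<or> par x \<rightarrow>\<^bsub>G\<^esub> x"
    and S: "S \<subseteq> verts G" and s: "s \<in> S" and x: "x \<in> verts G" and near: "near par t s x"
  shows "x \<in> (psd_round G ^^ t) S"
proof -
  interpret graph G using tree unfolding undirected_tree_def by blast
  interpret rooted_tree "verts G" apex par dep by (rule rt)
  let ?B = "\<lambda>t. (psd_round G ^^ t) S"
  have step: "z \<in> ?B (Suc m)" if "y \<in> ?B m" "y = z \<or> y \<rightarrow>\<^bsub>G\<^esub> z" for m y z
  proof (cases "z \<in> ?B m")
    case True
    then show ?thesis using psd_round_mono[of "?B m" G] by auto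
  next
    case False
    then have "psd_forces G (?B m) y z"
      using that psd_rounds_subset[OF wf_digraph S]
      by (intro tree_neighbour_forced[OF tree]) auto
    then show ?thesis unfolding psd_round_def by auto
  qed
  have up: "(par ^^ i) s \<in> ?B i" for i
  proof (induction i)
    case (Suc i)
    have "(par ^^ i) s \<in> verts G" using anc_in s S by blast
    then have "(par ^^ i) s = par ((par ^^ i) s) \<or> (par ^^ i) s \<rightarrow>\<^bsub>G\<^esub> par ((par ^^ i) s)"
      using par arcs_ends_symmetric[OF sym_arcs] by metis
    from step[OF Suc this] show ?case by simp
  qed (use s in simp)
  have down: "(par ^^ j) y \<in> ?B m \<Longrightarrow> y \<in> verts G \<Longrightarrow> y \<in> ?B (m + j)" for j m y
  proof (induction j arbitrary: m)
    case (Suc j)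
    have "(par ^^ j) y \<in> verts G" using Suc anc_in by blast
    then have "(par ^^ j) y \<in> ?B (Suc m)"
      using Suc.prems par by (intro step[of "(par ^^ Suc j) y" m]) auto
    from Suc.IH[OF this Suc.prems(2)] show ?case by simp
  qed simp
  obtain i j where ij: "i + j \<le> t" "(par ^^ i) s = (par ^^ j) x"
    using near unfolding near_def by blast
  have "x \<in> ?B (i + j)" using down[of j x i] up[of i] ij x by simp
  then show ?thesis by (rule subsetD[OF psd_rounds_mono[OF ij(1)]])
qed

theorem corollary3p2:
  shows "\<exists>C::real. \<forall>n\<ge>1. \<forall>T :: ('a, 'b) pre_digraph.
           undirected_tree T \<and> card (verts T) = n \<longrightarrow>
           ereal_of_enat (th_plus T) \<le> ereal (sqrt 14 / 2 * sqrt (real n) + C)"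
proof (intro exI[of _ 3] allI impI)
  fix n :: nat and T :: "('a, 'b) pre_digraph"
  assume "undirected_tree T \<and> card (verts T) = n"
  then have tree: "undirected_tree T" and n: "card (verts T) = n" by auto
  interpret graph T using tree unfolding undirected_tree_def by blast
  have connected: "Digraph_Component.connected T"
    using tree unfolding undirected_tree_def by blast
  obtain apex par dep where rt: "rooted_tree (verts T) apex par dep"
    and par: "\<forall>x\<in>verts T. par x = x \<or> par x \<rightarrow>\<^bsub>T\<^esub> x"
    by (rule obtain_rooted_tree[OF connected])
  interpret rooted_tree "verts T" apex par dep by (rule rt)
  obtain t S where "covers t S \<and> real (card S + t) \<le> sqrt 14 / 2 * sqrt (real n) + 3"
    using cover_sqrt_bound unfolding n by (elim exE) (rule that)
  then have S: "covers t S" "real (card S + t) \<le> sqrt 14 / 2 * sqrt (real n) + 3"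
    by simp_all
  then have sub: "S \<subseteq> verts T" "S \<noteq> {}" unfolding covers_def by auto
  have "x \<in> (psd_round T ^^ t) S" if x: "x \<in> verts T" for x
  proof -
    obtain s where s: "s \<in> S" "near par t s x" using S(1) x unfolding covers_def by auto
    show ?thesis by (rule tree_near_forced[OF tree rt bspec[OF par] sub(1) s(1) x s(2)])
  qed
  then have "(psd_round T ^^ t) S = verts T"
    using psd_rounds_subset[OF wf_digraph sub(1)] by blast
  then have "th_plus T \<le> enat (card S + t)"
    using sub finite_subset[OF sub(1)] by (intro th_plus_le) auto
  then have "ereal_of_enat (th_plus T) \<le> ereal_of_enat (enat (card S + t))"
    by (simp only: ereal_of_enat_le_iff)
  also have "\<dots> = ereal (real (card S + t))" by simp
  also have "\<dots> \<le> ereal (sqrt 14 / 2 * sqrt (real n) + 3)" using S(2) by simp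
  finally show "ereal_of_enat (th_plus T) \<le> ereal (sqrt 14 / 2 * sqrt (real n) + 3)" .
qed

end
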